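(* Let $\Omega'\subset\Omega$ be a subset which also satisfies condition C1. For any connected component $C$ of $\Gamma(\Omega,q)$, $\Pi_{\Omega/\Omega'}(C)$ is a connected component of $\Gamma(\Omega',q)$ and $\Pi_{\Omega/\Omega'}$ is a $t$-to-1 graph homomorphism from $C$ to $\Pi_{\Omega/\Omega'}(C)$ for some $t$ with $1\le t\le q^{|\Omega|-|\Omega'|}$.
   Context: Let $q$ be a prime power and $\mathbb{F}_q$ the field with $q$ elements. $\{0,1\}^*$ is the set of finite binary sequences, $\eta$ the null sequence; juxtaposition is concatenation. $\Omega\subset\{0,1\}^*$ is a finite set satisfying condition C1: $\eta\in\Omega$, and for any $\alpha\in\Omega\setminus\{\eta\}$ the sequence obtained by deleting the last bit of $\alpha$ is in $\Omega$. $L(\Omega)$ and $R(\Omega)$ are two disjoint copies of $\mathbb{F}_q^{|\Omega|+1}$; their vectors are written $[l]$ and $\langle r\rangle$ respectively, with entries indexed by $\Omega\cup\{*\}$, where $*\notin\Omega$ is an extra symbol. $\Gamma(\Omega,q)$ is the bipartite graph with vertex set $L(\Omega)\cup R(\Omega)$ in which $[l]\in L(\Omega)$ and $\langle r\rangle\in R(\Omega)$ are adjacent if and only if $l_\eta+r_\eta=l_*r_*$, $l_{\alpha0}+r_{\alpha0}=r_*l_\alpha$ for all $\alpha0\in\Omega$, and $l_{\beta1}+r_{\beta1}=l_*r_\beta$ for all $\beta1\in\Omega$ (here $\alpha,\beta\in\{0,1\}^*$). The same definitions apply to $\Omega'$. $\Pi_{\Omega/\Omega'}$ is the natural projection from $\Gamma(\Omega,q)$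 to $\Gamma(\Omega',q)$: it sends $L(\Omega)$ to $L(\Omega')$ and $R(\Omega)$ to $R(\Omega')$ by keeping only the entries indexed by $\Omega'\cup\{*\}$. "$t$-to-1" means that every vertex of the image has exactly $t$ preimages in $V(C)$. *)

theory Defs
  imports
    "HOL-Library.FuncSet"
    "HOL-Library.Cardinality"
    "Graph_Theory.Digraph_Component"
begin

text \<open>Bits are booleans (\<open>0\<close> is \<open>False\<close>, \<open>1\<close> is \<open>True\<close>); since juxtaposition appends on the right,
  the sequence \<open>\<alpha>0\<close> is \<open>\<alpha> @ [False]\<close> and \<open>\<alpha>1\<close> is \<open>\<alpha> @ [True]\<close>.\<close>

definition C1 :: "bool list set \<Rightarrow> bool" where
  "C1 \<Omega> \<longleftrightarrow> [] \<in> \<Omega> \<and> (\<forall>\<alpha>\<in>\<Omega> - {[]}. butlast \<alpha> \<in> \<Omega>)"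

text \<open>The index \<open>*\<close> is \<open>None\<close>, and \<open>\<alpha> \<in> \<Omega>\<close> is the index \<open>Some \<alpha>\<close>.\<close>

definition indices :: "bool list set \<Rightarrow> bool list option set" where
  "indices \<Omega> = insert None (Some ` \<Omega>)"

text \<open>Vectors are functions that are \<open>undefined\<close> outside the index set, so that distinct functions
  are distinct vectors. The field with \<open>q\<close> elements is a type \<open>'q\<close> of sort \<open>{field, finite}\<close>.\<close>

definition vectors :: "bool list set \<Rightarrow> (bool list option \<Rightarrow> 'q) set" where
  "vectors \<Omega> = indices \<Omega> \<rightarrow>\<^sub>E UNIV"

datatype 'q vertex = L "bool list option \<Rightarrow> 'q" | R "bool list option \<Rightarrow> 'q"

definition adjacent ::
    "bool list set \<Rightarrow> (bool list option \<Rightarrow> 'q::field) \<Rightarrow> (bool list option \<Rightarrow> 'q) \<Rightarrow> bool" where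
  "adjacent \<Omega> l r \<longleftrightarrow>
     l (Some []) + r (Some []) = l None * r None \<and>
     (\<forall>\<alpha>. \<alpha> @ [False] \<in> \<Omega> \<longrightarrow>
        l (Some (\<alpha> @ [False])) + r (Some (\<alpha> @ [False])) = r None * l (Some \<alpha>)) \<and>
     (\<forall>\<beta>. \<beta> @ [True] \<in> \<Omega> \<longrightarrow>
        l (Some (\<beta> @ [True])) + r (Some (\<beta> @ [True])) = l None * r (Some \<beta>))"

text \<open>An undirected edge is represented by the two opposite arcs.\<close>

definition Gamma :: "bool list set \<Rightarrow> 'q::{field,finite} vertex pair_pre_digraph" where
  "Gamma \<Omega> =
     \<lparr> pverts = L ` vectors \<Omega> \<union> R ` vectors \<Omega>,
       parcs = {(L l, R r) | l r. l \<in> vectors \<Omega> \<and> r \<in> vectors \<Omega> \<and> adjacent \<Omega> l r} \<union>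
               {(R r, L l) | l r. l \<in> vectors \<Omega> \<and> r \<in> vectors \<Omega> \<and> adjacent \<Omega> l r} \<rparr>"

lemma pair_graph_Gamma:
  assumes "finite \<Omega>"
  shows "pair_graph (Gamma \<Omega> :: 'q::{field,finite} vertex pair_pre_digraph)"
proof -
  let ?G = "Gamma \<Omega> :: 'q vertex pair_pre_digraph"
  have fin: "finite (vectors \<Omega> :: (bool list option \<Rightarrow> 'q) set)"
    using assms unfolding vectors_def indices_def by (intro finite_PiE) auto
  have wf: "parcs ?G \<subseteq> pverts ?G \<times> pverts ?G"
    by (auto simp: Gamma_def)
  have fv: "finite (pverts ?G)"
    using fin by (simp add: Gamma_def)
  have fa: "finite (parcs ?G)"
    using wf fv by (meson finite_SigmaI finite_subset)
  have sm: "sym (parcs ?G)"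
    by (auto simp: sym_def Gamma_def)
  have lf: "\<And>e. e \<in> parcs ?G \<Longrightarrow> fst e \<noteq> snd e"
    by (auto simp: Gamma_def)
  show ?thesis
    using wf fv fa sm lf by unfold_locales (auto simp: symmetric_def)
qed

fun projection :: "bool list set \<Rightarrow> 'q vertex \<Rightarrow> 'q vertex" where
  "projection \<Omega>' (L l) = L (restrict l (indices \<Omega>'))"
| "projection \<Omega>' (R r) = R (restrict r (indices \<Omega>'))"

text \<open>A connected component is a maximal connected subgraph (and in particular nonempty).\<close>

definition connected_component :: "'a pair_pre_digraph \<Rightarrow> 'a pair_pre_digraph \<Rightarrow> bool" where
  "connected_component G C \<longleftrightarrow> pre_digraph.max_subgraph (with_proj G) connected (with_proj C)"

definition graph_image :: "('a \<Rightarrow> 'b) \<Rightarrow> 'a pair_pre_digraph \<Rightarrow> 'b pair_pre_digraph" where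
  "graph_image f G = \<lparr> pverts = f ` pverts G, parcs = map_prod f f ` parcs G \<rparr>"

definition graph_homomorphism ::
    "('a \<Rightarrow> 'b) \<Rightarrow> 'a pair_pre_digraph \<Rightarrow> 'b pair_pre_digraph \<Rightarrow> bool" where
  "graph_homomorphism f G H \<longleftrightarrow>
     f \<in> pverts G \<rightarrow> pverts H \<and> (\<forall>(u, v)\<in>parcs G. (f u, f v) \<in> parcs H)"

definition t_to_1 :: "nat \<Rightarrow> ('a \<Rightarrow> 'b) \<Rightarrow> 'a set \<Rightarrow> bool" where
  "t_to_1 t f V \<longleftrightarrow> (\<forall>w\<in>f ` V. card {v \<in> V. f v = w} = t)"

end

theory Submission
  imports Defs
begin

text \<open>
  The projection is a covering map of graphs. Fix a vertex \<open>[l]\<close>. The equations that define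
  adjacency determine a neighbour \<open>\<langle>r\<rangle>\<close> completely once its entry \<open>r\<^sub>*\<close> is chosen:
  every further entry of \<open>r\<close> is given by an equation in terms of \<open>l\<close>, \<open>r\<^sub>*\<close> and the entry of \<open>r\<close> at
  a shorter sequence, and condition C1 keeps that shorter sequence in the index set. Every value
  of \<open>r\<^sub>*\<close> occurs. The same holds for the neighbours of a vertex \<open>\<langle>r\<rangle>\<close>, coloured by \<open>l\<^sub>*\<close>.
  As the projection preserves adjacency and keeps the entry at \<open>*\<close>, it maps the neighbours of
  a vertex bijectively onto the neighbours of its image (\<open>covering_projection\<close>).

  Everything else holds for any covering map between finite symmetric graphs. Walks lift, so the
  image of a component is the whole component of an image vertex
  (\<open>covering_component_image\<close>). An arc from \<open>x\<close> to \<open>y\<close> in the image carries the fibre over \<open>x\<close>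
  injectively into the fibre over \<open>y\<close>, and its opposite does the reverse; hence fibres over
  adjacent vertices are equally large, and by connectedness all fibres of a component are
  (\<open>covering_component_uniform_fibres\<close>). The bound on \<open>t\<close> counts the vectors with prescribed
  entries at \<open>*\<close> and on the smaller index set: only \<open>|\<Omega>| - |\<Omega>'|\<close> entries are free
  (\<open>card_projection_fibre_le\<close>).
\<close>

section \<open>Components of symmetric digraphs\<close>

lemma strongly_connected_imp_connected:
  assumes "strongly_connected G"
  shows "connected G"
proof -
  have "arcs_ends G \<subseteq> (arcs_ends G)\<^sup>s"
    by (auto simp: symcl_def)
  then show ?thesis
    using assms unfolding connected_conv strongly_connected_def reachable_def
    by (meson order_refl rtrancl_on_mono)
qed

lemma arc_mono_connected: "arc_mono connected"
  unfolding arc_mono_def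
  by (metis spanning_def subgraphE wf_digraph.connected_spanning_imp_connected)

lemma (in sym_digraph) connected_induced_imp_strongly_connected:
  assumes "induced_subgraph H G" and "connected H"
  shows "strongly_connected H"
proof -
  interpret H: sym_digraph H
    using assms(1) by (rule induced_graph_imp_graph)
  show ?thesis
    using H.sym_arcs assms(2) by (rule H.symmetric_connected_imp_strongly_connected)
qed

text \<open>
  Connectedness of a subgraph refers to its underlying undirected graph, and an arbitrary subgraph
  of a symmetric digraph need not be symmetric, so connected subgraphs and strongly connected
  subgraphs differ. The maximal ones agree: adding arcs preserves connectedness, so a maximal
  connected subgraph is induced, and induced subgraphs inherit the symmetry. This makes the theory
  of strongly connected components applicable to connected components.
\<close>

lemma (in sym_digraph) max_connected_iff_scc:
  "max_subgraph connected H \<longleftrightarrow> H \<in> sccs"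
proof
  assume max: "max_subgraph connected H"
  then have "induced_subgraph H G"
    using arc_mono_connected by (rule induced_subgraphI_arc_mono)
  then have "strongly_connected H"
    using max_subgraph_prop[OF max] by (rule connected_induced_imp_strongly_connected)
  with max show "H \<in> sccs"
    unfolding sccs_altdef2
    by (blast intro: max_subgraph_mp strongly_connected_imp_connected)
next
  assume H: "H \<in> sccs"
  then have ind: "induced_subgraph H G" and sc: "strongly_connected H"
    and max: "\<And>K. induced_subgraph K G \<Longrightarrow> strongly_connected K \<Longrightarrow> \<not> verts H \<subset> verts K"
    by (auto simp: sccs_def)
  show "max_subgraph connected H"
  proof (rule max_subgraphI)
    show "connected H"
      using sc by (rule strongly_connected_imp_connected)
    show "subgraph H G"
      using ind by (rule induced_imp_subgraph)
    fix K assume ne: "H \<noteq> K" and HK: "subgraph H K" and KG: "subgraph K G"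
    show "\<not> connected K"
    proof
      assume K: "connected K"
      \<comment> \<open>\<open>K\<close> itself may lack opposite arcs; the subgraph induced on its vertices is symmetric.\<close>
      let ?I = "G \<restriction> verts K"
      have indI: "induced_subgraph ?I G"
        using KG by (intro induced_induce subgraph_imp_subverts)
      have "subgraph K ?I"
        using KG by (rule subgraph_induce_subgraphI2)
      then have "connected ?I"
        using K arc_mono_connected unfolding arc_mono_def by (metis induce_subgraph_verts)
      then have "strongly_connected ?I"
        by (rule connected_induced_imp_strongly_connected[OF indI])
      with max[OF indI] HK have "verts K = verts H"
        using subgraph_imp_subverts by auto
      then have "max_subgraph (\<lambda>H'. verts H' = verts H) H" "verts K = verts H"
        using ind by (simp_all add: induced_subgraph_altdef2)
      then show False
        using ne HK KG by (auto simp: max_subgraph_def)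
    qed
  qed
qed

lemma (in pair_sym_digraph) connected_component_iff:
  "connected_component G C \<longleftrightarrow>
     (\<exists>u\<in>pverts G. pverts C = {v. u \<rightarrow>\<^sup>*\<^bsub>with_proj G\<^esub> v} \<and> parcs C = {(a, b) \<in> parcs G. u \<rightarrow>\<^sup>*\<^bsub>with_proj G\<^esub> a})"
proof -
  have scc: "scc_of u = {v. u \<rightarrow>\<^sup>*\<^bsub>with_proj G\<^esub> v}" for u
    using symmetric_reachable' by (auto simp: scc_of_def)
  have eq: "with_proj C = with_proj G \<restriction> {v. u \<rightarrow>\<^sup>*\<^bsub>with_proj G\<^esub> v} \<longleftrightarrow>
      pverts C = {v. u \<rightarrow>\<^sup>*\<^bsub>with_proj G\<^esub> v} \<and> parcs C = {(a, b) \<in> parcs G. u \<rightarrow>\<^sup>*\<^bsub>with_proj G\<^esub> a}" for u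
  proof -
    have "with_proj C = with_proj G \<restriction> S \<longleftrightarrow>
        pverts C = S \<and> parcs C = {e \<in> parcs G. fst e \<in> S \<and> snd e \<in> S}" for S
      by (simp add: with_proj_def induce_subgraph_def)
    moreover have "{e \<in> parcs G. u \<rightarrow>\<^sup>*\<^bsub>with_proj G\<^esub> fst e \<and> u \<rightarrow>\<^sup>*\<^bsub>with_proj G\<^esub> snd e} = {(a, b) \<in> parcs G. u \<rightarrow>\<^sup>*\<^bsub>with_proj G\<^esub> a}"
      by (auto intro: reachable_adj_trans)
    ultimately show ?thesis by simp
  qed
  have "connected_component G C \<longleftrightarrow> with_proj C \<in> (\<lambda>u. with_proj G \<restriction> {v. u \<rightarrow>\<^sup>*\<^bsub>with_proj G\<^esub> v}) ` pverts G"
    unfolding connected_component_def max_connected_iff_scc sccs_conv_sccs_verts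
      sccs_verts_conv_scc_of scc image_image by simp
  then show ?thesis
    by (auto simp: image_iff eq)
qed

section \<open>Covering maps\<close>

text \<open>
  Every arc at the image of \<open>u\<close> has exactly one lift starting at \<open>u\<close>: the map is bijective on
  neighbourhoods. It may miss whole components of the target.
\<close>

definition covering :: "('a \<Rightarrow> 'b) \<Rightarrow> 'a pair_pre_digraph \<Rightarrow> 'b pair_pre_digraph \<Rightarrow> bool" where
  "covering f G H \<longleftrightarrow> graph_homomorphism f G H \<and>
     (\<forall>u\<in>pverts G. \<forall>w. (f u, w) \<in> parcs H \<longrightarrow> (\<exists>!v. (u, v) \<in> parcs G \<and> f v = w))"

lemma covering_vertex: "covering f G H \<Longrightarrow> u \<in> pverts G \<Longrightarrow> f u \<in> pverts H"
  by (auto simp: covering_def graph_homomorphism_def)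

lemma covering_arc: "covering f G H \<Longrightarrow> (u, v) \<in> parcs G \<Longrightarrow> (f u, f v) \<in> parcs H"
  by (auto simp: covering_def graph_homomorphism_def)

lemma covering_lift:
  assumes "covering f G H" and "u \<in> pverts G" and "(f u, w) \<in> parcs H"
  obtains v where "(u, v) \<in> parcs G" and "f v = w"
  using assms unfolding covering_def by blast

lemma covering_lift_unique:
  assumes "covering f G H" and "u \<in> pverts G"
    and "(u, v) \<in> parcs G" and "(u, v') \<in> parcs G" and "f v = f v'"
  shows "v = v'"
proof -
  have "(f u, f v) \<in> parcs H"
    using assms(1,3) by (rule covering_arc)
  then show ?thesis
    using assms unfolding covering_def by metis
qed

text \<open>
  Walks project along the homomorphism, and a walk starting at \<open>f u\<close> is lifted arc by arc to
  a walk starting at \<open>u\<close>.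
\<close>

lemma covering_image_reachable:
  assumes cov: "covering f G H" and G: "pair_wf_digraph G" and H: "pair_wf_digraph H"
    and u: "u \<in> pverts G"
  shows "f ` {v. u \<rightarrow>\<^sup>*\<^bsub>with_proj G\<^esub> v} = {w. f u \<rightarrow>\<^sup>*\<^bsub>with_proj H\<^esub> w}"
proof -
  interpret G: pair_wf_digraph G by fact
  interpret H: pair_wf_digraph H by fact
  have "f u \<rightarrow>\<^sup>*\<^bsub>with_proj H\<^esub> f v" if "u \<rightarrow>\<^sup>*\<^bsub>with_proj G\<^esub> v" for v
    using that
  proof (induction rule: G.reachable_induct)
    case base
    then show ?case using covering_vertex[OF cov] by auto
  next
    case (step x y)
    then have "(f x, f y) \<in> parcs H"
      using covering_arc[OF cov] by simp
    with step.IH show ?case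
      by (rule H.reachable_adj_trans)
  qed
  moreover have "\<exists>v. u \<rightarrow>\<^sup>*\<^bsub>with_proj G\<^esub> v \<and> f v = w" if "f u \<rightarrow>\<^sup>*\<^bsub>with_proj H\<^esub> w" for w
    using that
  proof (induction rule: H.reachable_induct)
    case base
    then show ?case using u by auto
  next
    case (step x y)
    then obtain v where v: "u \<rightarrow>\<^sup>*\<^bsub>with_proj G\<^esub> v" "f v = x" by blast
    then have "v \<in> pverts G" using G.reachable_in_verts by blast
    with step v obtain v' where "(v, v') \<in> parcs G" "f v' = y"
      using covering_lift[OF cov, of v y] by auto
    with v show ?case using G.reachable_adj_trans by blast
  qed
  ultimately show ?thesis by blast
qed

text \<open>
  Components are the classes of reachability, so on vertices this is
  \<open>covering_image_reachable\<close>. An arc between vertices of the image is itself the image of an arc,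
  because it lifts at any preimage of its first end and that lift stays in the component.
\<close>

lemma covering_component_image:
  assumes cov: "covering f G H" and G: "pair_sym_digraph G" and H: "pair_sym_digraph H"
    and C: "connected_component G C"
  shows "connected_component H (graph_image f C)"
proof -
  interpret G: pair_sym_digraph G by fact
  interpret H: pair_sym_digraph H by fact
  obtain u where u: "u \<in> pverts G" and verts: "pverts C = {v. u \<rightarrow>\<^sup>*\<^bsub>with_proj G\<^esub> v}"
    and arcs: "parcs C = {(a, b) \<in> parcs G. u \<rightarrow>\<^sup>*\<^bsub>with_proj G\<^esub> a}"
    using C unfolding G.connected_component_iff by blast
  have img: "f ` {v. u \<rightarrow>\<^sup>*\<^bsub>with_proj G\<^esub> v} = {w. f u \<rightarrow>\<^sup>*\<^bsub>with_proj H\<^esub> w}"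
    using cov G.pair_wf_digraph_axioms H.pair_wf_digraph_axioms u by (rule covering_image_reachable)
  have "map_prod f f ` parcs C = {(a, b) \<in> parcs H. f u \<rightarrow>\<^sup>*\<^bsub>with_proj H\<^esub> a}" (is "?A = ?B")
  proof
    show "?A \<subseteq> ?B"
      using img covering_arc[OF cov] unfolding arcs by auto
    show "?B \<subseteq> ?A"
    proof clarify
      fix a b assume ab: "(a, b) \<in> parcs H" and "f u \<rightarrow>\<^sup>*\<^bsub>with_proj H\<^esub> a"
      then obtain x where x: "u \<rightarrow>\<^sup>*\<^bsub>with_proj G\<^esub> x" "a = f x"
        using img by blast
      then have "x \<in> pverts G" using G.reachable_in_verts by blast
      with ab x obtain y where "(x, y) \<in> parcs G" "f y = b"
        using covering_lift[OF cov, of x b] by auto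
      with x show "(a, b) \<in> ?A"
        unfolding arcs by (auto intro!: rev_image_eqI[of "(x, y)"])
    qed
  qed
  then show ?thesis
    unfolding H.connected_component_iff graph_image_def
    using img verts covering_vertex[OF cov u] by auto
qed

text \<open>
  Lifting an arc \<open>(x, y)\<close> at each point of the fibre over \<open>x\<close> gives an injection into the
  fibre over \<open>y\<close>: two lifts with the same end, read backwards, are lifts of \<open>(y, x)\<close> at
  that end and so coincide. By symmetry the fibres over \<open>x\<close> and \<open>y\<close> have the same size, and
  this size propagates along walks.
\<close>

lemma covering_component_uniform_fibres:
  assumes cov: "covering f G H" and G: "pair_pseudo_graph G" and H: "pair_sym_digraph H"
    and C: "connected_component G C"
  obtains w where "1 \<le> card {v \<in> pverts C. f v = w}"
    and "t_to_1 (card {v \<in> pverts C. f v = w}) f (pverts C)"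
proof -
  interpret G: pair_pseudo_graph G by fact
  interpret H: pair_sym_digraph H by fact
  obtain u where u: "u \<in> pverts G" and verts: "pverts C = {v. u \<rightarrow>\<^sup>*\<^bsub>with_proj G\<^esub> v}"
    using C unfolding G.connected_component_iff by blast
  have img: "f ` pverts C = {w. f u \<rightarrow>\<^sup>*\<^bsub>with_proj H\<^esub> w}"
    unfolding verts
    using cov G.pair_wf_digraph_axioms H.pair_wf_digraph_axioms u by (rule covering_image_reachable)
  have sub: "pverts C \<subseteq> pverts G"
    unfolding verts using G.reachable_in_verts by blast
  then have fin: "finite (pverts C)"
    using G.pair_finite_verts by (rule finite_subset)
  define F where "F w = {v \<in> pverts C. f v = w}" for w
  have finF: "finite (F w)" for w
    unfolding F_def using fin by simp
  have le: "card (F x) \<le> card (F y)" if xy: "(x, y) \<in> parcs H" for x y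
  proof -
    have "\<exists>v'. (v, v') \<in> parcs G \<and> f v' = y" if "v \<in> F x" for v
      using that sub xy covering_lift[OF cov, of v y] unfolding F_def by blast
    then obtain g where g: "\<And>v. v \<in> F x \<Longrightarrow> (v, g v) \<in> parcs G \<and> f (g v) = y"
      by metis
    have "inj_on g (F x)"
    proof (rule inj_onI)
      fix v v' assume v: "v \<in> F x" "v' \<in> F x" and eq: "g v = g v'"
      have "(g v, v) \<in> parcs G" "(g v, v') \<in> parcs G"
        using g[OF v(1)] g[OF v(2)] eq G.arcs_symmetric by auto
      moreover from this have "g v \<in> pverts G" using G.in_arcsD1 by blast
      ultimately show "v = v'"
        using v covering_lift_unique[OF cov] unfolding F_def by blast
    qed
    moreover have "g ` F x \<subseteq> F y"
    proof
      fix z assume "z \<in> g ` F x"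
      then obtain v where v: "v \<in> F x" "z = g v" by blast
      then have "u \<rightarrow>\<^sup>*\<^bsub>with_proj G\<^esub> z"
        using g[OF v(1)] G.reachable_adj_trans unfolding F_def verts by blast
      then show "z \<in> F y" using v g unfolding F_def verts by blast
    qed
    ultimately show ?thesis using finF by (rule card_inj_on_le)
  qed
  have const: "card (F w) = card (F (f u))" if "f u \<rightarrow>\<^sup>*\<^bsub>with_proj H\<^esub> w" for w
    using that
  proof (induction rule: H.reachable_induct)
    case base
    show ?case ..
  next
    case (step x y)
    then have "(x, y) \<in> parcs H" by simp
    then have "card (F x) = card (F y)"
      using le H.arcs_symmetric by (meson le_antisym)
    with step.IH show ?case by simp
  qed
  have uC: "u \<in> pverts C" using u verts by auto
  have "u \<in> F (f u)" using uC unfolding F_def by simp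
  then have "1 \<le> card (F (f u))"
    using finF by (metis One_nat_def Suc_leI card_gt_0_iff empty_iff)
  moreover have "t_to_1 (card (F (f u))) f (pverts C)"
    using const unfolding t_to_1_def img F_def by blast
  ultimately show ?thesis using that unfolding F_def by blast
qed

section \<open>Neighbours in the graph\<close>

text \<open>
  Exchanging the roles of \<open>l\<close> and \<open>r\<close> in the definition of adjacency amounts to exchanging the
  two bits. With the bit \<open>c\<close> as a parameter one relation describes the neighbours of both kinds of
  vertices: \<open>u\<close> is the given vector, \<open>v\<close> is the unknown one, and \<open>c\<close> is the bit at which
  the equation involves the previous entry of \<open>v\<close> rather than that of \<open>u\<close>.
\<close>

definition neighbour ::
    "bool \<Rightarrow> bool list set \<Rightarrow> (bool list option \<Rightarrow> 'q::field) \<Rightarrow> (bool list option \<Rightarrow> 'q) \<Rightarrow> bool" where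
  "neighbour c \<Omega> u v \<longleftrightarrow>
     u (Some []) + v (Some []) = u None * v None \<and>
     (\<forall>\<alpha> x. \<alpha> @ [x] \<in> \<Omega> \<longrightarrow> u (Some (\<alpha> @ [x])) + v (Some (\<alpha> @ [x])) =
        (if x = c then u None * v (Some \<alpha>) else v None * u (Some \<alpha>)))"

lemma adjacent_iff_neighbour:
  "adjacent \<Omega> l r \<longleftrightarrow> neighbour True \<Omega> l r"
  "adjacent \<Omega> l r \<longleftrightarrow> neighbour False \<Omega> r l"
  unfolding adjacent_def neighbour_def
  by (auto simp: add.commute mult.commute all_bool_eq)

lemma C1_prefix: "C1 \<Omega> \<Longrightarrow> \<alpha> @ [x] \<in> \<Omega> \<Longrightarrow> \<alpha> \<in> \<Omega>"
  unfolding C1_def by (metis Diff_iff butlast_snoc insertE empty_iff snoc_eq_iff_butlast)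

lemma restrict_vectors: "restrict u (indices \<Omega>) \<in> vectors \<Omega>"
  by (simp add: vectors_def)

lemma neighbour_cong:
  assumes "C1 \<Omega>"
    and "\<And>i. i \<in> indices \<Omega> \<Longrightarrow> u i = u' i" and "\<And>i. i \<in> indices \<Omega> \<Longrightarrow> v i = v' i"
  shows "neighbour c \<Omega> u v \<longleftrightarrow> neighbour c \<Omega> u' v'"
proof -
  have None: "u None = u' None" "v None = v' None"
    using assms(2,3) by (auto simp: indices_def)
  have Some: "u (Some \<alpha>) = u' (Some \<alpha>)" "v (Some \<alpha>) = v' (Some \<alpha>)" if "\<alpha> \<in> \<Omega>" for \<alpha>
    using assms(2,3) that by (auto simp: indices_def)
  have Nil: "[] \<in> \<Omega>" using assms(1) by (simp add: C1_def)
  have "u (Some (\<alpha> @ [x])) + v (Some (\<alpha> @ [x])) =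
        (if x = c then u None * v (Some \<alpha>) else v None * u (Some \<alpha>)) \<longleftrightarrow>
      u' (Some (\<alpha> @ [x])) + v' (Some (\<alpha> @ [x])) =
        (if x = c then u' None * v' (Some \<alpha>) else v' None * u' (Some \<alpha>))"
    if "\<alpha> @ [x] \<in> \<Omega>" for \<alpha> x
    using Some[OF that] Some[OF C1_prefix[OF assms(1) that]] None by simp
  then show ?thesis
    using Some[OF Nil] None unfolding neighbour_def by simp
qed

lemma neighbour_restrict:
  assumes "C1 \<Omega>'" and "\<Omega>' \<subseteq> \<Omega>" and "neighbour c \<Omega> u v"
  shows "neighbour c \<Omega>' (restrict u (indices \<Omega>')) (restrict v (indices \<Omega>'))"
proof -
  have "neighbour c \<Omega>' u v"
    using assms(2,3) unfolding neighbour_def by blast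
  then show ?thesis
    using neighbour_cong[OF assms(1), of u "restrict u (indices \<Omega>')" v "restrict v (indices \<Omega>')" c]
    by simp
qed

text \<open>
  Each equation determines an entry of the unknown vector from its entry at \<open>*\<close> and its entry
  at the sequence with the last bit deleted; induct on the length of the sequence.
\<close>

lemma neighbour_unique:
  assumes C1: "C1 \<Omega>" and v: "v \<in> vectors \<Omega>" and w: "w \<in> vectors \<Omega>"
    and nv: "neighbour c \<Omega> u v" and nw: "neighbour c \<Omega> u w" and None: "v None = w None"
  shows "v = w"
proof -
  have "\<alpha> \<in> \<Omega> \<Longrightarrow> v (Some \<alpha>) = w (Some \<alpha>)" for \<alpha>
  proof (induction \<alpha> rule: rev_induct)
    case Nil
    have "u (Some []) + v (Some []) = u (Some []) + w (Some [])"
      using nv nw None unfolding neighbour_def by simp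
    then show ?case by simp
  next
    case (snoc x \<alpha>)
    then have "v (Some \<alpha>) = w (Some \<alpha>)"
      using C1_prefix[OF C1] by blast
    then have "u (Some (\<alpha> @ [x])) + v (Some (\<alpha> @ [x])) = u (Some (\<alpha> @ [x])) + w (Some (\<alpha> @ [x]))"
      using nv nw None snoc.prems unfolding neighbour_def by simp
    then show ?case by simp
  qed
  then have "v i = w i" if "i \<in> indices \<Omega>" for i
    using that None by (auto simp: indices_def)
  with v w show ?thesis
    unfolding vectors_def by (rule PiE_ext)
qed

text \<open>
  The entries of the neighbour with \<open>a\<close> at \<open>*\<close>, obtained by solving the equations one
  after another. The recursion removes the last bit of a sequence, hence the argument is
  the reversed sequence.
\<close>

primrec solve_rev :: "bool \<Rightarrow> (bool list option \<Rightarrow> 'q::field) \<Rightarrow> 'q \<Rightarrow> bool list \<Rightarrow> 'q" where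
  "solve_rev c u a [] = u None * a - u (Some [])"
| "solve_rev c u a (x # xs) =
     (if x = c then u None * solve_rev c u a xs else a * u (Some (rev xs))) - u (Some (rev (x # xs)))"

lemma neighbour_exists:
  assumes "C1 \<Omega>"
  obtains v where "v \<in> vectors \<Omega>" and "neighbour c \<Omega> u v" and "v None = a"
proof -
  define s where "s = case_option a (\<lambda>\<alpha>. solve_rev c u a (rev \<alpha>))"
  let ?v = "restrict s (indices \<Omega>)"
  have "neighbour c \<Omega> u s"
    unfolding neighbour_def s_def by simp
  then have "neighbour c \<Omega> u ?v"
    using neighbour_cong[OF assms, of u u s ?v] by simp
  moreover have "?v None = a"
    by (simp add: s_def indices_def)
  ultimately show ?thesis
    using that restrict_vectors by blast
qed

text \<open>
  The local bijectivity of the projection, in terms of vectors. The only candidate for a lift is the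
  neighbour of \<open>u\<close> whose entry at \<open>*\<close> agrees with that of \<open>v'\<close>. Its restriction and \<open>v'\<close> are
  neighbours of the same vector with the same entry at \<open>*\<close>, so uniqueness over the smaller
  index set identifies them.
\<close>

lemma neighbour_lift:
  assumes C1: "C1 \<Omega>" "C1 \<Omega>'" and sub: "\<Omega>' \<subseteq> \<Omega>"
    and v': "v' \<in> vectors \<Omega>'" and nb: "neighbour c \<Omega>' (restrict u (indices \<Omega>')) v'"
  shows "\<exists>!v. v \<in> vectors \<Omega> \<and> neighbour c \<Omega> u v \<and> restrict v (indices \<Omega>') = v'"
proof -
  have None: "restrict v (indices \<Omega>') None = v None" for v :: "bool list option \<Rightarrow> 'a"
    by (simp add: indices_def)
  obtain v where v: "v \<in> vectors \<Omega>" "neighbour c \<Omega> u v" "v None = v' None"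
    using neighbour_exists[OF C1(1)] by metis
  have "restrict v (indices \<Omega>') = v'"
    using C1(2) restrict_vectors v' neighbour_restrict[OF C1(2) sub v(2)] nb
    by (rule neighbour_unique) (simp add: v(3) indices_def)
  with v None show ?thesis
    using neighbour_unique[OF C1(1)] by metis
qed

section \<open>The projection\<close>

lemma covering_projection:
  assumes C1: "C1 \<Omega>" "C1 \<Omega>'" and sub: "\<Omega>' \<subseteq> \<Omega>"
  shows "covering (projection \<Omega>') (Gamma \<Omega> :: 'q::{field,finite} vertex pair_pre_digraph) (Gamma \<Omega>')"
proof -
  let ?G = "Gamma \<Omega> :: 'q vertex pair_pre_digraph" and ?H = "Gamma \<Omega>' :: 'q vertex pair_pre_digraph"
  have "graph_homomorphism (projection \<Omega>') ?G ?H"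
    by (auto simp: graph_homomorphism_def Gamma_def restrict_vectors adjacent_iff_neighbour(1)
        intro!: neighbour_restrict[OF C1(2) sub])
  moreover have "\<exists>!v. (u, v) \<in> parcs ?G \<and> projection \<Omega>' v = w"
    if u: "u \<in> pverts ?G" and arc: "(projection \<Omega>' u, w) \<in> parcs ?H" for u w
  proof (cases u)
    case (L l)
    then have l: "l \<in> vectors \<Omega>" using u by (auto simp: Gamma_def)
    obtain r' where w: "w = R r'" "r' \<in> vectors \<Omega>'"
      and nb: "neighbour True \<Omega>' (restrict l (indices \<Omega>')) r'"
      using arc L by (auto simp: Gamma_def adjacent_iff_neighbour(1))
    obtain r where r: "r \<in> vectors \<Omega>" "neighbour True \<Omega> l r" "restrict r (indices \<Omega>') = r'"
      and uniq: "\<And>s. s \<in> vectors \<Omega> \<Longrightarrow> neighbour True \<Omega> l s \<Longrightarrow> restrict s (indices \<Omega>') = r' \<Longrightarrow> s = r"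
      using neighbour_lift[OF C1 sub w(2) nb] by metis
    show ?thesis
    proof (rule ex1I[of _ "R r"])
      show "(u, R r) \<in> parcs ?G \<and> projection \<Omega>' (R r) = w"
        using L l w r by (auto simp: Gamma_def adjacent_iff_neighbour(1))
      show "v = R r" if "(u, v) \<in> parcs ?G \<and> projection \<Omega>' v = w" for v
        using that L w uniq by (auto simp: Gamma_def adjacent_iff_neighbour(1))
    qed
  next
    case (R r)
    then have r: "r \<in> vectors \<Omega>" using u by (auto simp: Gamma_def)
    obtain l' where w: "w = L l'" "l' \<in> vectors \<Omega>'"
      and nb: "neighbour False \<Omega>' (restrict r (indices \<Omega>')) l'"
      using arc R by (auto simp: Gamma_def adjacent_iff_neighbour(2))
    obtain l where l: "l \<in> vectors \<Omega>" "neighbour False \<Omega> r l" "restrict l (indices \<Omega>') = l'"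
      and uniq: "\<And>s. s \<in> vectors \<Omega> \<Longrightarrow> neighbour False \<Omega> r s \<Longrightarrow> restrict s (indices \<Omega>') = l' \<Longrightarrow> s = l"
      using neighbour_lift[OF C1 sub w(2) nb] by metis
    show ?thesis
    proof (rule ex1I[of _ "L l"])
      show "(u, L l) \<in> parcs ?G \<and> projection \<Omega>' (L l) = w"
        using R r w l by (auto simp: Gamma_def adjacent_iff_neighbour(2))
      show "v = L l" if "(u, v) \<in> parcs ?G \<and> projection \<Omega>' v = w" for v
        using that R w uniq by (auto simp: Gamma_def adjacent_iff_neighbour(2))
    qed
  qed
  ultimately show ?thesis
    unfolding covering_def by blast
qed

text \<open>
  A vector in the fibre is determined by its entries on \<open>\<Omega> - \<Omega>'\<close>.
\<close>

lemma card_vectors_fibre_le: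
  fixes w :: "bool list option \<Rightarrow> 'q::finite"
  assumes fin: "finite \<Omega>" and sub: "\<Omega>' \<subseteq> \<Omega>"
  shows "finite {v \<in> vectors \<Omega>. restrict v (indices \<Omega>') = w}" (is "finite ?F")
    and "card {v \<in> vectors \<Omega>. restrict v (indices \<Omega>') = w} \<le> CARD('q) ^ (card \<Omega> - card \<Omega>')"
proof -
  let ?D = "Some ` (\<Omega> - \<Omega>')" and ?g = "\<lambda>v. restrict v (Some ` (\<Omega> - \<Omega>'))"
  have inj: "inj_on ?g ?F"
  proof (rule inj_onI)
    fix v v' assume v: "v \<in> ?F" "v' \<in> ?F" and eq: "?g v = ?g v'"
    have "v i = v' i" if "i \<in> indices \<Omega>" for i
    proof (cases "i \<in> indices \<Omega>'")
      case True
      then show ?thesis using v by (metis (mono_tags, lifting) mem_Collect_eq restrict_apply')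
    next
      case False
      then have "i \<in> ?D" using that by (auto simp: indices_def)
      then show ?thesis using eq by (metis restrict_apply')
    qed
    with v show "v = v'"
      unfolding vectors_def by (auto intro: PiE_ext)
  qed
  have ran: "?g ` ?F \<subseteq> ?D \<rightarrow>\<^sub>E (UNIV :: 'q set)"
    by auto
  have finD: "finite (?D \<rightarrow>\<^sub>E (UNIV :: 'q set))"
    using fin by (intro finite_PiE) auto
  show "finite ?F"
    using inj_on_finite[OF inj ran finD] .
  have "card ?F \<le> card (?D \<rightarrow>\<^sub>E (UNIV :: 'q set))"
    using inj ran finD by (rule card_inj_on_le)
  also have "\<dots> = CARD('q) ^ card ?D"
    using fin by (simp add: card_PiE)
  also have "card ?D = card \<Omega> - card \<Omega>'"
    using fin sub by (simp add: card_image card_Diff_subset finite_subset)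
  finally show "card ?F \<le> CARD('q) ^ (card \<Omega> - card \<Omega>')" .
qed

lemma card_projection_fibre_le:
  fixes w :: "'q::{field,finite} vertex"
  assumes "finite \<Omega>" and "\<Omega>' \<subseteq> \<Omega>" and "V \<subseteq> pverts (Gamma \<Omega>)"
  shows "card {v \<in> V. projection \<Omega>' v = w} \<le> CARD('q) ^ (card \<Omega> - card \<Omega>')"
proof -
  define F where "F x = {v \<in> vectors \<Omega>. restrict v (indices \<Omega>') = x}" for x :: "bool list option \<Rightarrow> 'q"
  have F: "finite (F x)" "card (F x) \<le> CARD('q) ^ (card \<Omega> - card \<Omega>')" for x
    unfolding F_def using card_vectors_fibre_le[OF assms(1,2)] by auto
  obtain c x where c: "c = L \<or> c = R" and w: "w = c x"
    by (metis vertex.exhaust)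
  have "{v \<in> V. projection \<Omega>' v = w} \<subseteq> c ` F x"
    using assms(3) c w by (fastforce simp: Gamma_def F_def)
  then have "card {v \<in> V. projection \<Omega>' v = w} \<le> card (F x)"
    using F(1) by (meson card_image_le card_mono finite_imageI le_trans)
  also note F(2)
  finally show ?thesis .
qed

theorem theorem5:
  fixes \<Omega> \<Omega>' :: "bool list set"
    and C :: "'q::{field,finite} vertex pair_pre_digraph"
  assumes "finite \<Omega>" and "C1 \<Omega>"
    and "\<Omega>' \<subseteq> \<Omega>" and "C1 \<Omega>'"
    and "connected_component (Gamma \<Omega>) C"
  shows "connected_component (Gamma \<Omega>') (graph_image (projection \<Omega>') C) \<and>
    (\<exists>t. 1 \<le> t \<and> t \<le> CARD('q) ^ (card \<Omega> - card \<Omega>') \<and>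
      graph_homomorphism (projection \<Omega>') C (graph_image (projection \<Omega>') C) \<and>
      t_to_1 t (projection \<Omega>') (pverts C))"
proof -
  let ?G = "Gamma \<Omega> :: 'q vertex pair_pre_digraph" and ?H = "Gamma \<Omega>' :: 'q vertex pair_pre_digraph"
  interpret G: pair_graph ?G
    using assms(1) by (rule pair_graph_Gamma)
  interpret H: pair_graph ?H
    using assms(1,3) by (intro pair_graph_Gamma) (rule finite_subset)
  have cov: "covering (projection \<Omega>') ?G ?H"
    using assms by (intro covering_projection)
  have comp: "connected_component ?H (graph_image (projection \<Omega>') C)"
    using cov G.pair_sym_digraph_axioms H.pair_sym_digraph_axioms assms(5)
    by (rule covering_component_image)
  obtain w where pos: "1 \<le> card {v \<in> pverts C. projection \<Omega>' v = w}"
    and uniform: "t_to_1 (card {v \<in> pverts C. projection \<Omega>' v = w}) (projection \<Omega>') (pverts C)"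
    using cov G.pair_pseudo_graph_axioms H.pair_sym_digraph_axioms assms(5)
    by (rule covering_component_uniform_fibres)
  have "pverts C \<subseteq> pverts ?G"
    using assms(5) G.reachable_in_verts unfolding G.connected_component_iff by blast
  then have "card {v \<in> pverts C. projection \<Omega>' v = w} \<le> CARD('q) ^ (card \<Omega> - card \<Omega>')"
    using assms(1,3) by (intro card_projection_fibre_le)
  moreover have "graph_homomorphism (projection \<Omega>') C (graph_image (projection \<Omega>') C)"
    by (auto simp: graph_homomorphism_def graph_image_def intro: rev_image_eqI)
  ultimately show ?thesis
    using comp pos uniform by blast
qed

end
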